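(* Let $q>2$ be a prime power, let $t>1$ be an integer, and let $f(x)\in\mathbb F_{q^t}[x]$ be a scattered $\mathbb F_q$-linearized polynomial such that $0,1\notin L_f$, where $L_f=\{f(x)/x : x\in\mathbb F_{q^t}^*\}$. Let $Q_f=\mathbb F_{q^t}$ be endowed with the sum of $\mathbb F_{q^t}$, and define, for any $x,m\in Q_f$, $$x\circ m=\begin{cases} xm & \text{if } m\notin L_f,\\ h^{-1}f(hx) & \text{if } m\in L_f \text{ and } f(h)-mh=0,\ h\neq 0.\end{cases}$$ Then $(Q_f,+,\circ)$ is a (right) quasifield, and its kernel is $K(Q_f)=\mathbb F_q$.
   Context: An $\mathbb F_q$-linearized polynomial in $\mathbb F_{q^t}[x]$ is one of the form $f(x)=\sum_{i=0}^k a_ix^{q^i}$. It is called scattered if for all $y,z\in\mathbb F_{q^t}$ the condition $zf(y)-yf(z)=0$ implies that $y$ and $z$ are linearly dependent over $\mathbb F_q$. In the definition of $\circ$, for $m\in L_f$ the element $h\in\mathbb F_{q^t}^*$ is any nonzero solution of $f(h)=mh$; since $f$ is scattered, $h$ is determined up to a factor in $\mathbb F_q^*$, and the value $h^{-1}f(hx)$ does not depend on the choice. A (right) quasifield is a triple $(Q,+,\circ)$ where $Q$ is a set, $(Q,+)$ is an abelian group, $(Q^*,\circ)$ is a loop (with $Q^*=Q\setminus\{0\}$), $(x+y)\circ m=x\circ m+y\circ m$ for all $x,y,m\in Q$, and for all $a,b,c\in Q$ with $a\neq b$ the equation $x\circ a=x\circ b+c$ in the unknown $x\in Q$ has a unique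 solution. The kernel of $Q$ is $$K(Q)=\{k\in Q : k\circ(x+y)=k\circ x+k\circ y \text{ and } k\circ(x\circ y)=(k\circ x)\circ y \text{ for all } x,y\in Q\}.$$ *)

theory Defs
  imports
    "HOL-Algebra.Group"
    "HOL-Computational_Algebra.Polynomial"
    "HOL-Number_Theory.Prime_Powers"
begin

text \<open>
  A field \<open>F\<close> of order \<open>q ^ t\<close> is modelled by a type of sort \<open>{field, finite}\<close> whose cardinality is
  \<open>q ^ t\<close>, and its subfield of order \<open>q\<close> by a set \<open>K\<close> of elements of that type.
\<close>

definition subfield_of_type :: "'a::field set \<Rightarrow> bool" where
  "subfield_of_type K \<longleftrightarrow>
     0 \<in> K \<and> 1 \<in> K \<and>
     (\<forall>x\<in>K. \<forall>y\<in>K. x - y \<in> K) \<and>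
     (\<forall>x\<in>K. \<forall>y\<in>K. x * y \<in> K) \<and>
     (\<forall>x\<in>K. inverse x \<in> K)"

definition linearized_poly :: "nat \<Rightarrow> 'a::field poly \<Rightarrow> bool" where
  "linearized_poly q f \<longleftrightarrow> (\<exists>k a. f = (\<Sum>i\<le>k. monom (a i) (q ^ i)))"

text \<open>Linear dependence of the family \<open>(y, z)\<close>; in particular \<open>(y, y)\<close> is always dependent.\<close>

definition lin_dependent_over :: "'a::field set \<Rightarrow> 'a \<Rightarrow> 'a \<Rightarrow> bool" where
  "lin_dependent_over K y z \<longleftrightarrow>
     (\<exists>a\<in>K. \<exists>b\<in>K. (a \<noteq> 0 \<or> b \<noteq> 0) \<and> a * y + b * z = 0)"

definition scattered :: "'a::field set \<Rightarrow> 'a poly \<Rightarrow> bool" where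
  "scattered K f \<longleftrightarrow>
     (\<forall>y z. z * poly f y - y * poly f z = 0 \<longrightarrow> lin_dependent_over K y z)"

definition L_set :: "'a::field poly \<Rightarrow> 'a set" where
  "L_set f = {poly f x / x | x. x \<noteq> 0}"

text \<open>
  For a scattered linearized \<open>f\<close> the value in the second case does not depend on the chosen \<open>h\<close>.
\<close>

definition circ_op :: "'a::field poly \<Rightarrow> 'a \<Rightarrow> 'a \<Rightarrow> 'a" where
  "circ_op f x m =
     (if m \<notin> L_set f then x * m
      else (let h = (SOME h. h \<noteq> 0 \<and> poly f h - m * h = 0)
            in inverse h * poly f (h * x)))"

definition loop_on :: "'a set \<Rightarrow> ('a \<Rightarrow> 'a \<Rightarrow> 'a) \<Rightarrow> bool" where
  "loop_on S mul \<longleftrightarrow>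
     (\<forall>x\<in>S. \<forall>y\<in>S. mul x y \<in> S) \<and>
     (\<forall>a\<in>S. \<forall>b\<in>S. \<exists>!x. x \<in> S \<and> mul a x = b) \<and>
     (\<forall>a\<in>S. \<forall>b\<in>S. \<exists>!y. y \<in> S \<and> mul y a = b) \<and>
     (\<exists>e\<in>S. \<forall>x\<in>S. mul e x = x \<and> mul x e = x)"

definition right_quasifield ::
    "'a set \<Rightarrow> ('a \<Rightarrow> 'a \<Rightarrow> 'a) \<Rightarrow> 'a \<Rightarrow> ('a \<Rightarrow> 'a \<Rightarrow> 'a) \<Rightarrow> bool" where
  "right_quasifield Q add z mul \<longleftrightarrow>
     comm_group \<lparr>carrier = Q, monoid.mult = add, one = z\<rparr> \<and>
     (\<forall>x\<in>Q. \<forall>y\<in>Q. mul x y \<in> Q) \<and>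
     loop_on (Q - {z}) mul \<and>
     (\<forall>x\<in>Q. \<forall>y\<in>Q. \<forall>m\<in>Q. mul (add x y) m = add (mul x m) (mul y m)) \<and>
     (\<forall>a\<in>Q. \<forall>b\<in>Q. \<forall>c\<in>Q. a \<noteq> b \<longrightarrow>
        (\<exists>!x. x \<in> Q \<and> mul x a = add (mul x b) c))"

definition quasifield_kernel ::
    "'a set \<Rightarrow> ('a \<Rightarrow> 'a \<Rightarrow> 'a) \<Rightarrow> ('a \<Rightarrow> 'a \<Rightarrow> 'a) \<Rightarrow> 'a set" where
  "quasifield_kernel Q add mul =
     {k \<in> Q. \<forall>x\<in>Q. \<forall>y\<in>Q.
        mul k (add x y) = add (mul k x) (mul k y) \<and>
        mul k (mul x y) = mul (mul k x) y}"

end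

theory Submission
  imports Defs "HOL-Number_Theory.Residues"
begin

text \<open>
  Each right multiplication \<open>x \<mapsto> x \<circ> m\<close> is additive and maps \<open>1\<close> to \<open>m\<close>, and scatteredness says
  exactly that the right multiplications by two distinct elements never agree at a nonzero point.
  On a finite field this already gives the loop and quasifield axioms.
  The elements of \<open>K\<close> lie in the kernel because \<open>k \<circ> m = k m\<close> for \<open>k \<in> K\<close>.
  Conversely, if \<open>k\<close> is in the kernel then \<open>m \<mapsto> k \<circ> m\<close> is additive and agrees with \<open>m \<mapsto> k m\<close>
  outside \<open>L\<^sub>f\<close>. As \<open>q > 2\<close>, the set \<open>L\<^sub>f\<close> contains fewer than half of the elements of the field, so
  every element is a sum of two elements outside \<open>L\<^sub>f\<close> and the two maps agree everywhere. Taking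
  \<open>m = f(1)\<close> gives \<open>f(k) = k f(1)\<close>, and scatteredness forces \<open>k \<in> K\<close>.
\<close>

section \<open>Linearized polynomials\<close>

lemma prime_CHAR_finite_field: "prime CHAR('a::{field,finite})"
  by (simp add: finite_imp_CHAR_pos prime_CHAR_semidom)

text \<open>The characteristic divides the order of the field, which is a power of the one prime
  dividing \<open>q\<close>. Needed to see the exponents \<open>q ^ i\<close> as Frobenius
  exponents.\<close>

lemma primepow_eq_CHAR_power:
  assumes "primepow q" "card (UNIV :: 'a::{field,finite} set) = q ^ t"
  shows "\<exists>n. q = CHAR('a) ^ n"
proof -
  obtain p k where p: "prime p" "q = p ^ k"
    using assms(1) unfolding primepow_def by blast
  have "CHAR('a) dvd p ^ (k * t)"
    using CHAR_dvd_CARD[where ?'a = 'a] assms(2) p(2) by (simp add: power_mult)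
  then have "CHAR('a) dvd p"
    using prime_CHAR_finite_field prime_dvd_power by blast
  then have "CHAR('a) = p"
    using prime_CHAR_finite_field p(1) primes_dvd_imp_eq by blast
  with p(2) show ?thesis
    by blast
qed

text \<open>Multiplication by a nonzero \<open>x\<close> permutes \<open>K - {0}\<close>; comparing
  the products of all its elements gives \<open>x ^ (card K - 1) = 1\<close>.\<close>

lemma subfield_power_card_eq_same:
  fixes K :: "'a::{field,finite} set"
  assumes K: "subfield_of_type K" and "x \<in> K"
  shows "x ^ card K = x"
proof (cases "x = 0")
  case False
  have "0 \<in> K"
    using K by (simp add: subfield_of_type_def)
  then have card: "card K = Suc (card (K - {0}))"
    by (intro card.remove) simp_all
  have mult: "y * x \<in> K" "y / x \<in> K" if "y \<in> K" for y
    using K \<open>x \<in> K\<close> that by (auto simp: subfield_of_type_def divide_inverse)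
  have "(\<Prod>y\<in>K-{0}. y * x) = (\<Prod>y\<in>K-{0}. y)"
    by (rule prod.reindex_bij_witness[of _ "\<lambda>y. y / x" "\<lambda>y. y * x"])
       (use False mult in auto)
  then have "(\<Prod>y\<in>K-{0}. y) * x ^ card (K - {0}) = (\<Prod>y\<in>K-{0}. y)"
    by (simp add: prod.distrib)
  moreover have "(\<Prod>y\<in>K-{0}. y) \<noteq> 0"
    by simp
  ultimately show ?thesis
    by (simp add: card)
qed (use assms in \<open>auto simp: card_gt_0_iff\<close>)

lemma poly_linearized_add:
  fixes f :: "'a::{field,finite} poly"
  assumes "linearized_poly (CHAR('a) ^ n) f"
  shows "poly f (x + y) = poly f x + poly f y"
proof -
  obtain k a where f: "f = (\<Sum>i\<le>k. Polynomial.monom (a i) ((CHAR('a) ^ n) ^ i))"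
    using assms unfolding linearized_poly_def by blast
  have "(x + y) ^ ((CHAR('a) ^ n) ^ i) = x ^ ((CHAR('a) ^ n) ^ i) + y ^ ((CHAR('a) ^ n) ^ i)" for i
    by (rule freshmans_dream'[OF prime_CHAR_finite_field, of _ "n * i"]) (simp add: power_mult)
  then show ?thesis
    by (simp add: f poly_sum poly_monom algebra_simps sum.distrib)
qed

lemma poly_linearized_scale:
  fixes f :: "'a::field poly"
  assumes "linearized_poly q f" "c ^ q = c"
  shows "poly f (c * x) = c * poly f x"
proof -
  obtain k a where f: "f = (\<Sum>i\<le>k. Polynomial.monom (a i) (q ^ i))"
    using assms unfolding linearized_poly_def by blast
  have "c ^ (q ^ i) = c" for i
    by (induction i) (simp_all add: assms(2) power_mult)
  then show ?thesis
    by (simp add: f poly_sum poly_monom algebra_simps sum_distrib_left)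
qed

section \<open>Scattered linear maps\<close>

text \<open>From here on the polynomial enters only as a \<open>K\<close>-linear scattered map; its
  coefficients and the numbers \<open>q\<close> and \<open>t\<close> have been abstracted
  away.\<close>

locale scattered_linear =
  fixes K :: "'a::{field,finite} set" and f :: "'a poly"
  assumes subfield: "subfield_of_type K"
    and add: "poly f (x + y) = poly f x + poly f y"
    and scale: "c \<in> K \<Longrightarrow> poly f (c * x) = c * poly f x"
    and scattered: "scattered K f"
    and zero_notin: "0 \<notin> L_set f"
    and one_notin: "1 \<notin> L_set f"
begin

abbreviation circ :: "'a \<Rightarrow> 'a \<Rightarrow> 'a"  (infixl "\<circ>\<^sub>f" 70)
  where "x \<circ>\<^sub>f m \<equiv> circ_op f x m"

lemma ratio_mult:
  assumes "c \<in> K" "c \<noteq> 0"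
  shows "poly f (c * x) / (c * x) = poly f x / x"
  using assms by (simp add: scale)

text \<open>Scatteredness restated for the map \<open>x \<mapsto> poly f x / x\<close>: with
  \<open>ratio_mult\<close>, its fibres on nonzero elements are exactly the orbits of scaling by
  \<open>K - {0}\<close>.\<close>

lemma ratio_eqD:
  assumes "poly f y / y = poly f z / z" "y \<noteq> 0" "z \<noteq> 0"
  shows "\<exists>c\<in>K. c \<noteq> 0 \<and> y = c * z"
proof -
  have "z * poly f y - y * poly f z = 0"
    using assms by (simp add: field_simps)
  with scattered obtain a b where ab: "a \<in> K" "b \<in> K" "a \<noteq> 0 \<or> b \<noteq> 0" "a * y + b * z = 0"
    unfolding scattered_def lin_dependent_over_def by blast
  \<comment> \<open>If one coefficient vanished, the other would annihilate a nonzero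
    element.\<close>
  have "a \<noteq> 0" "b \<noteq> 0"
    using ab(3,4) assms(2,3) by auto
  have "0 \<in> K"
    using subfield by (simp add: subfield_of_type_def)
  then have "0 - inverse a * b \<in> K"
    using subfield ab(1,2) unfolding subfield_of_type_def by blast
  moreover have "y = (0 - inverse a * b) * z"
  proof -
    have "a * y = - b * z"
      using ab(4) by (simp add: eq_neg_iff_add_eq_0)
    then show ?thesis
      using \<open>a \<noteq> 0\<close> by (simp add: field_simps)
  qed
  ultimately show ?thesis
    using \<open>a \<noteq> 0\<close> \<open>b \<noteq> 0\<close> by (intro bexI[of _ "0 - inverse a * b"]) simp_all
qed

section \<open>Basic laws of the multiplication\<close>

lemma circ_notin: "m \<notin> L_set f \<Longrightarrow> x \<circ>\<^sub>f m = x * m"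
  by (simp add: circ_op_def)

lemma circ_in:
  assumes "m \<in> L_set f"
  obtains h where "h \<noteq> 0" "poly f h / h = m" "\<And>x. x \<circ>\<^sub>f m = poly f (h * x) / h"
proof -
  define h where "h = (SOME h. h \<noteq> 0 \<and> poly f h - m * h = 0)"
  have "\<exists>h. h \<noteq> 0 \<and> poly f h - m * h = 0"
    using assms unfolding L_set_def by auto
  then have h: "h \<noteq> 0 \<and> poly f h - m * h = 0"
    unfolding h_def by (rule someI_ex)
  show ?thesis
  proof (rule that)
    show "x \<circ>\<^sub>f m = poly f (h * x) / h" for x
      unfolding circ_op_def Let_def h_def[symmetric] using assms
      by (simp add: divide_inverse mult.commute)
  qed (use h in \<open>auto simp: field_simps\<close>)
qed

text \<open>The choice of \<open>h\<close> is immaterial: two choices differ by a factor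
  \<open>c\<close> in \<open>K\<close>, which cancels between numerator and denominator.\<close>

lemma circ_ratio:
  assumes "h \<noteq> 0"
  shows "x \<circ>\<^sub>f (poly f h / h) = poly f (h * x) / h"
proof -
  have "poly f h / h \<in> L_set f"
    using assms by (auto simp: L_set_def)
  then obtain g where g: "g \<noteq> 0" "poly f g / g = poly f h / h"
    "x \<circ>\<^sub>f (poly f h / h) = poly f (g * x) / g"
    by (metis circ_in)
  then obtain c where "c \<in> K" "c \<noteq> 0" "g = c * h"
    using ratio_eqD assms by blast
  then show ?thesis
    using g(3) scale[of c "h * x"] by (simp add: mult.assoc)
qed

lemma circ_add_left: "(x + y) \<circ>\<^sub>f m = x \<circ>\<^sub>f m + y \<circ>\<^sub>f m"
proof (cases "m \<in> L_set f")
  case True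
  then show ?thesis
    by (rule circ_in) (simp add: distrib_left add add_divide_distrib)
qed (simp add: circ_notin distrib_right)

lemma circ_scale_left:
  assumes "k \<in> K"
  shows "(k * x) \<circ>\<^sub>f m = k * (x \<circ>\<^sub>f m)"
proof (cases "m \<in> L_set f")
  case True
  then show ?thesis
    by (rule circ_in) (simp add: mult.left_commute[of _ k] scale[OF assms])
qed (simp add: circ_notin)

lemma zero_circ: "0 \<circ>\<^sub>f m = 0"
  using circ_add_left[of 0 0 m] by (metis add.right_neutral add_left_cancel)

lemma circ_zero: "x \<circ>\<^sub>f 0 = 0"
  using zero_notin by (simp add: circ_notin)

lemma circ_one: "x \<circ>\<^sub>f 1 = x"
  using one_notin by (simp add: circ_notin)

lemma one_circ: "1 \<circ>\<^sub>f m = m"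
proof (cases "m \<in> L_set f")
  case True
  then show ?thesis
    by (rule circ_in) simp
qed (simp add: circ_notin)

text \<open>The only place in the quasifield axioms where the shape of the product matters. The
  quotient of \<open>x \<circ>\<^sub>f m\<close> by \<open>x\<close> is a ratio of \<open>f\<close>
  at \<open>h * x\<close> if \<open>m\<close> is in \<open>L_set f\<close>, and is \<open>m\<close>
  otherwise; so the two cases cannot mix, and within the first case equal ratios force proportional
  \<open>h\<close>.\<close>

lemma circ_right_cancel:
  assumes "x \<circ>\<^sub>f m = x \<circ>\<^sub>f n" "x \<noteq> 0"
  shows "m = n"
proof -
  have mixed: False if "x \<circ>\<^sub>f m = x \<circ>\<^sub>f n" "m \<in> L_set f" "n \<notin> L_set f" for m n
  proof -
    obtain h where h: "h \<noteq> 0" "\<And>x. x \<circ>\<^sub>f m = poly f (h * x) / h"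
      using circ_in[OF \<open>m \<in> L_set f\<close>] by metis
    have "poly f (h * x) / h = x * n"
      using that h(2) by (simp add: circ_notin)
    then have "n = poly f (h * x) / (h * x)"
      using \<open>x \<noteq> 0\<close> h(1) by (simp add: field_simps)
    then have "n \<in> L_set f"
      using h(1) \<open>x \<noteq> 0\<close> unfolding L_set_def by force
    then show False
      using \<open>n \<notin> L_set f\<close> by simp
  qed
  consider "m \<in> L_set f" "n \<in> L_set f" | "m \<notin> L_set f" "n \<notin> L_set f"
    using mixed[of m n] mixed[of n m] assms(1) by auto
  then show ?thesis
  proof cases
    case 1
    obtain h where h: "h \<noteq> 0" "poly f h / h = m" "\<And>x. x \<circ>\<^sub>f m = poly f (h * x) / h"
      using circ_in[OF 1(1)] by metis
    obtain g where g: "g \<noteq> 0" "poly f g / g = n" "\<And>x. x \<circ>\<^sub>f n = poly f (g * x) / g"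
      using circ_in[OF 1(2)] by metis
    have "poly f (h * x) / h / x = poly f (g * x) / g / x"
      using assms(1) h(3) g(3) by simp
    then have "poly f (h * x) / (h * x) = poly f (g * x) / (g * x)"
      by simp
    then obtain c where "c \<in> K" "c \<noteq> 0" "h * x = c * (g * x)"
      using ratio_eqD h(1) g(1) assms(2) by (metis mult_eq_0_iff)
    \<comment> \<open>Cancelling \<open>x\<close> leaves \<open>h = c * g\<close>, so
      \<open>h\<close> and \<open>g\<close> have the same ratio, that is
      \<open>m = n\<close>.\<close>
    then show ?thesis
      using assms(2) ratio_mult h(2) g(2) by (simp flip: mult.assoc)
  next
    case 2
    then show ?thesis
      using assms by (simp add: circ_notin)
  qed
qed

lemma bij_circ_left:
  assumes "x \<noteq> 0"
  shows "bij (\<lambda>m. x \<circ>\<^sub>f m)"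
proof -
  have "inj (\<lambda>m. x \<circ>\<^sub>f m)"
    using circ_right_cancel assms by (blast intro: injI)
  then show ?thesis
    by (simp add: bij_def finite_UNIV_inj_surj)
qed

text \<open>The map is additive, and by cancellation it vanishes only at 0; finiteness turns
  injectivity into bijectivity.\<close>

lemma bij_circ_diff:
  assumes "m \<noteq> n"
  shows "bij (\<lambda>x. x \<circ>\<^sub>f m - x \<circ>\<^sub>f n)"
proof -
  have "inj (\<lambda>x. x \<circ>\<^sub>f m - x \<circ>\<^sub>f n)"
  proof (rule injI)
    fix x y assume "x \<circ>\<^sub>f m - x \<circ>\<^sub>f n = y \<circ>\<^sub>f m - y \<circ>\<^sub>f n"
    moreover have "x \<circ>\<^sub>f k = (x - y) \<circ>\<^sub>f k + y \<circ>\<^sub>f k" for k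
      by (simp flip: circ_add_left)
    ultimately have "(x - y) \<circ>\<^sub>f m = (x - y) \<circ>\<^sub>f n"
      by (simp add: algebra_simps)
    then show "x = y"
      using circ_right_cancel assms by fastforce
  qed
  then show ?thesis
    by (simp add: bij_def finite_UNIV_inj_surj)
qed

lemma right_quasifield_circ: "right_quasifield UNIV (+) 0 (circ_op f)"
proof -
  have nonzero: "x \<circ>\<^sub>f m \<noteq> 0" if "x \<noteq> 0" "m \<noteq> 0" for x m
    using circ_right_cancel[of x m 0] that by (auto simp: circ_zero)
  have left_div: "\<exists>!x. x \<in> UNIV - {0} \<and> a \<circ>\<^sub>f x = b" if "a \<noteq> 0" "b \<noteq> 0" for a b
  proof -
    have "\<exists>!x. a \<circ>\<^sub>f x = b"
      using bij_circ_left[OF \<open>a \<noteq> 0\<close>] by (simp add: bij_iff)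
    moreover have "x \<noteq> 0" if "a \<circ>\<^sub>f x = b" for x
      using that \<open>b \<noteq> 0\<close> circ_zero by metis
    ultimately show ?thesis
      by blast
  qed
  have right_div: "\<exists>!y. y \<in> UNIV - {0} \<and> y \<circ>\<^sub>f a = b" if "a \<noteq> 0" "b \<noteq> 0" for a b
  proof -
    \<comment> \<open>The case \<open>n = 0\<close> of the difference map, since
      \<open>x \<circ>\<^sub>f 0 = 0\<close>.\<close>
    have "bij (\<lambda>x. x \<circ>\<^sub>f a)"
      using bij_circ_diff[OF \<open>a \<noteq> 0\<close>] by (simp add: circ_zero)
    then have "\<exists>!y. y \<circ>\<^sub>f a = b"
      by (simp add: bij_iff)
    moreover have "y \<noteq> 0" if "y \<circ>\<^sub>f a = b" for y
      using that \<open>b \<noteq> 0\<close> zero_circ by metis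
    ultimately show ?thesis
      by blast
  qed
  have "loop_on (UNIV - {0}) (circ_op f)"
    unfolding loop_on_def
  proof (intro conjI ballI)
    show "\<exists>e\<in>UNIV - {0}. \<forall>x\<in>UNIV - {0}. e \<circ>\<^sub>f x = x \<and> x \<circ>\<^sub>f e = x"
      by (rule bexI[of _ 1]) (simp_all add: circ_one one_circ)
  next
    fix a b :: 'a assume ab: "a \<in> UNIV - {0}" "b \<in> UNIV - {0}"
    then show "a \<circ>\<^sub>f b \<in> UNIV - {0}"
      by (simp add: nonzero)
    show "\<exists>!x. x \<in> UNIV - {0} \<and> a \<circ>\<^sub>f x = b"
      by (rule left_div) (use ab in simp_all)
    show "\<exists>!y. y \<in> UNIV - {0} \<and> y \<circ>\<^sub>f a = b"
      by (rule right_div) (use ab in simp_all)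
  qed
  moreover have "\<exists>!x. x \<circ>\<^sub>f a = x \<circ>\<^sub>f b + c" if "a \<noteq> b" for a b c
  proof -
    have "\<exists>!x. x \<circ>\<^sub>f a - x \<circ>\<^sub>f b = c"
      using bij_circ_diff[OF that] by (simp add: bij_iff)
    then show ?thesis
      by (simp only: diff_eq_eq add.commute[of c])
  qed
  moreover have "comm_group \<lparr>carrier = (UNIV :: 'a set), monoid.mult = (+), one = 0\<rparr>"
    by (rule comm_groupI) (simp_all add: ac_simps, metis add.right_inverse)
  ultimately show ?thesis
    by (simp add: right_quasifield_def circ_add_left)
qed

section \<open>The kernel\<close>

lemma circ_eq_mult_of_subfield:
  assumes "k \<in> K"
  shows "k \<circ>\<^sub>f m = k * m"
  using circ_scale_left[OF assms, of 1 m] by (simp add: one_circ)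

lemma subfield_subset_kernel: "K \<subseteq> quasifield_kernel UNIV (+) (circ_op f)"
  unfolding quasifield_kernel_def
  by (auto simp: circ_eq_mult_of_subfield circ_scale_left distrib_left)

text \<open>Choose one \<open>h m\<close> above each ratio \<open>m\<close>. The chosen elements and
  their multiples by \<open>c\<close> form two disjoint sets of nonzero elements, each as large as
  \<open>L_set f\<close>.\<close>

lemma card_L_set:
  assumes "c \<in> K" "c \<noteq> 0" "c \<noteq> 1"
  shows "2 * card (L_set f) < card (UNIV :: 'a set)"
proof -
  have "\<forall>m\<in>L_set f. \<exists>h. h \<noteq> 0 \<and> poly f h / h = m"
    by (auto simp: L_set_def)
  then obtain h where h: "\<And>m. m \<in> L_set f \<Longrightarrow> h m \<noteq> 0 \<and> poly f (h m) / h m = m"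
    by metis
  let ?A = "h ` L_set f" and ?B = "(\<lambda>m. c * h m) ` L_set f"
  have inj: "inj_on h (L_set f)"
    using h by (metis inj_onI)
  then have inj': "inj_on (\<lambda>m. c * h m) (L_set f)"
    using assms(2) by (auto simp: inj_on_def)
  have "?A \<inter> ?B = {}"
  proof (rule ccontr)
    assume "?A \<inter> ?B \<noteq> {}"
    then obtain m n where mn: "m \<in> L_set f" "n \<in> L_set f" "h m = c * h n"
      by auto
    then have "m = poly f (c * h n) / (c * h n)"
      using h by metis
    \<comment> \<open>Scaling by \<open>c\<close> preserves the ratio, so \<open>m = n\<close>; then
      \<open>h n = c * h n\<close> contradicts the choice of \<open>c\<close>.\<close>
    also have "\<dots> = n"
      using ratio_mult[OF assms(1,2)] h[OF mn(2)] by metis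
    finally have "h n = c * h n"
      using mn(3) by simp
    then show False
      using h[OF mn(2)] assms(3) by (metis mult_cancel_right1)
  qed
  then have "2 * card (L_set f) = card (?A \<union> ?B)"
    by (simp add: card_Un_disjoint card_image inj inj')
  also have "\<dots> < card (UNIV :: 'a set)"
  proof (rule psubset_card_mono)
    have "0 \<notin> ?A \<union> ?B"
      using h assms(2) by auto
    then show "?A \<union> ?B \<subset> UNIV"
      by blast
  qed simp
  finally show ?thesis .
qed

text \<open>Pigeonhole: \<open>L_set f\<close> and its reflection \<open>m - L_set f\<close>
  together cannot cover the field, so some \<open>u\<close> avoids both, and
  \<open>v = m - u\<close> works.\<close>

lemma sum_of_two_notin_L_set:
  assumes "c \<in> K" "c \<noteq> 0" "c \<noteq> 1"
  shows "\<exists>u v. u \<notin> L_set f \<and> v \<notin> L_set f \<and> u + v = m"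
proof -
  let ?B = "(\<lambda>v. m - v) ` L_set f"
  have "card (L_set f \<union> ?B) \<le> 2 * card (L_set f)"
    using card_Un_le[of "L_set f" ?B] card_image_le[of "L_set f" "\<lambda>v. m - v"] by simp
  then have "card (L_set f \<union> ?B) < card (UNIV :: 'a set)"
    using card_L_set[OF assms] by simp
  then have "L_set f \<union> ?B \<noteq> UNIV"
    by auto
  then obtain u where u: "u \<notin> L_set f" "u \<notin> ?B"
    by blast
  have "m - u \<notin> L_set f"
    using u(2) by (metis diff_diff_eq2 add_diff_cancel_left' image_eqI)
  with u(1) show ?thesis
    by (metis add_diff_eq add_diff_cancel_left')
qed

lemma kernel_subset_subfield:
  assumes c: "c \<in> K" "c \<noteq> 0" "c \<noteq> 1"
  shows "quasifield_kernel UNIV (+) (circ_op f) \<subseteq> K"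
proof
  fix k assume "k \<in> quasifield_kernel UNIV (+) (circ_op f)"
  then have k: "k \<circ>\<^sub>f (x + y) = k \<circ>\<^sub>f x + k \<circ>\<^sub>f y" for x y
    unfolding quasifield_kernel_def by blast
  have k_circ: "k \<circ>\<^sub>f m = k * m" for m
  proof -
    obtain u v where uv: "u \<notin> L_set f" "v \<notin> L_set f" "u + v = m"
      using sum_of_two_notin_L_set[OF c] by metis
    then show ?thesis
      using k[of u v] uv(1,2) by (simp add: circ_notin distrib_left flip: uv(3))
  qed
  show "k \<in> K"
  proof (cases "k = 0")
    case True
    then show ?thesis
      using subfield by (simp add: subfield_of_type_def)
  next
    case False
    \<comment> \<open>With \<open>h = 1\<close> the product of \<open>k\<close> with the ratio
      \<open>poly f 1\<close> is \<open>poly f k\<close>.\<close>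
    have "poly f k = k * poly f 1"
      using circ_ratio[of 1 k] k_circ by simp
    then have "poly f k / k = poly f 1 / 1"
      using False by simp
    then show ?thesis
      using ratio_eqD[of k 1] False by auto
  qed
qed

end

theorem proposition3p1:
  fixes q t :: nat
    and K :: "'a::{field,finite} set"
    and f :: "'a poly"
  assumes "primepow q"
    and "q > 2"
    and "t > 1"
    and "card (UNIV :: 'a set) = q ^ t"
    and "subfield_of_type K"
    and "card K = q"
    and "linearized_poly q f"
    and "scattered K f"
    and "0 \<notin> L_set f"
    and "1 \<notin> L_set f"
  shows "right_quasifield (UNIV :: 'a set) (+) 0 (circ_op f)
       \<and> quasifield_kernel (UNIV :: 'a set) (+) (circ_op f) = K"
proof -
  obtain n where n: "q = CHAR('a) ^ n"
    using primepow_eq_CHAR_power assms(1,4) by blast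
  interpret scattered_linear K f
  proof
    show "poly f (x + y) = poly f x + poly f y" for x y
      using poly_linearized_add assms(7) n by blast
    show "poly f (c * x) = c * poly f x" if "c \<in> K" for c x
      using poly_linearized_scale[OF assms(7)] subfield_power_card_eq_same[OF assms(5) that] assms(6)
      by simp
  qed (use assms in auto)
  \<comment> \<open>Here \<open>q > 2\<close> enters: it supplies the scalar \<open>c\<close> for
    the counting argument.\<close>
  have "\<not> K \<subseteq> {0, 1}"
  proof
    assume "K \<subseteq> {0, 1}"
    then have "card K \<le> card {0, 1 :: 'a}"
      by (rule card_mono[rotated]) simp
    then show False
      using assms(2,6) by simp
  qed
  then obtain c where "c \<in> K" "c \<noteq> 0" "c \<noteq> 1"
    by blast
  then show ?thesis
    using right_quasifield_circ kernel_subset_subfield subfield_subset_kernel by blast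
qed

end
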